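(* Let $\alpha,\beta,\gamma,\delta>0$ and let $u,v>0$ be real numbers. Let $P_1,P_2,P_3,P_4$ be four points of Euclidean three-dimensional space with $|P_1P_2|=\alpha$, $|P_2P_3|=\beta$, $|P_3P_4|=\gamma$, $|P_4P_1|=\delta$, $|P_1P_3|=u$, $|P_2P_4|=v$. Then the four points are coplanar if and only if $$u^4v^2+u^2v^4+h_{11}u^2v^2+h_{10}u^2+h_{01}v^2+h_{00}=0,$$ where $$h_{11}=-(\alpha^2+\beta^2+\gamma^2+\delta^2),\qquad h_{10}=-(\beta^2-\gamma^2)(\delta^2-\alpha^2),$$ $$h_{01}=-(\alpha^2-\beta^2)(\gamma^2-\delta^2),\qquad h_{00}=(\alpha^2\gamma^2-\beta^2\delta^2)(\alpha^2-\beta^2+\gamma^2-\delta^2).$$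
   Context: This is the relation between the lengths $u,v$ of the two diagonals of a planar 4-bar linkage (a planar quadrilateral, possibly self-intersecting) with bar lengths, in cyclic order, $\alpha,\beta,\gamma,\delta$. The diagonal $u$ forms triangles with side lengths $(\alpha,\beta,u)$ and $(\gamma,\delta,u)$, and the diagonal $v$ forms triangles with side lengths $(\beta,\gamma,v)$ and $(\delta,\alpha,v)$. *)

theory Defs
  imports "HOL-Analysis.Analysis"
begin

end

theory Submission
  imports Defs
begin

text \<open>
  With \<open>x, y, z\<close> the vectors from \<open>P1\<close> to \<open>P2, P3, P4\<close>, the points are coplanar exactly when the
  triple product of \<open>x, y, z\<close> vanishes. Its square is the Gram determinant of \<open>x, y, z\<close>, and writing
  the inner products through the six distances turns the stated polynomial into \<open>-4\<close> times this
  determinant.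
\<close>

text \<open>The triple product is the determinant of the matrix \<open>M\<close> with rows
  \<open>x, y, z\<close>, so its square is the determinant of \<open>M\<close> times its transpose,
  the Gram matrix. The right-hand side is that determinant expanded along the first row.\<close>

lemma gram_det_eq_triple_product_sq:
  fixes x y z :: "real ^ 3"
  shows "(x \<bullet> cross3 y z)\<^sup>2 =
    (x \<bullet> x) * ((y \<bullet> y) * (z \<bullet> z) - (y \<bullet> z)\<^sup>2)
    - (x \<bullet> y) * ((x \<bullet> y) * (z \<bullet> z) - (y \<bullet> z) * (x \<bullet> z))
    + (x \<bullet> z) * ((x \<bullet> y) * (y \<bullet> z) - (y \<bullet> y) * (x \<bullet> z))"
  unfolding cross3_def inner_vec_def sum_3 vector_def
  by (simp add: power2_eq_square) algebra

lemma triple_product_zero_imp_combination: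
  fixes x y z :: "real ^ 3"
  assumes "x \<bullet> cross3 y z = 0" and "cross3 y z \<noteq> 0"
  obtains s t where "x = s *\<^sub>R y + t *\<^sub>R z"
proof -
  define n where "n = cross3 y z"
  \<comment> \<open>Cramer's rule for \<open>x\<close> in the basis \<open>y, z, n\<close>, cleared
    of the denominator \<open>n \<bullet> n\<close>, which is the determinant of that basis. The
    assumption then removes the component along the normal \<open>n\<close>.\<close>
  have "(n \<bullet> n) *\<^sub>R x
      = (n \<bullet> cross3 x z) *\<^sub>R y + (n \<bullet> cross3 y x) *\<^sub>R z + (x \<bullet> n) *\<^sub>R n"
    unfolding n_def by (simp add: cross3_simps forall_3)
  then have scaled: "(n \<bullet> n) *\<^sub>R x = (n \<bullet> cross3 x z) *\<^sub>R y + (n \<bullet> cross3 y x) *\<^sub>R z"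
    using assms(1) by (simp add: n_def)
  have "n \<bullet> n \<noteq> 0"
    using assms(2) by (simp add: n_def)
  then have "x = inverse (n \<bullet> n) *\<^sub>R ((n \<bullet> n) *\<^sub>R x)"
    by simp
  also have "\<dots> = (inverse (n \<bullet> n) * (n \<bullet> cross3 x z)) *\<^sub>R y
      + (inverse (n \<bullet> n) * (n \<bullet> cross3 y x)) *\<^sub>R z"
    unfolding scaled by (simp add: scaleR_add_right)
  finally show thesis
    by (rule that)
qed

text \<open>In a common plane the three differences lie in the span of two vectors, hence are
  dependent. Conversely, either \<open>a, c, d\<close> span a plane and \<open>b\<close> lies in it,
  or they are collinear and a plane through their line and \<open>b\<close> exists.\<close>

lemma coplanar_4_iff_triple_product_zero:
  fixes a b c d :: "real ^ 3"
  shows "coplanar {a, b, c, d} \<longleftrightarrow> (b - a) \<bullet> cross3 (c - a) (d - a) = 0"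
proof
  assume "coplanar {a, b, c, d}"
  then obtain p q r where "{a, b, c, d} \<subseteq> affine hull {p, q, r}"
    unfolding coplanar_def by blast
  moreover have "\<exists>s t. x = p + s *\<^sub>R (q - p) + t *\<^sub>R (r - p)" if x: "x \<in> affine hull {p, q, r}" for x
  proof -
    obtain k s t where comb: "x = k *\<^sub>R p + s *\<^sub>R q + t *\<^sub>R r" and "k + s + t = 1"
      using x unfolding affine_hull_3 by blast
    then have k: "k = 1 - s - t"
      by linarith
    have "x = p + s *\<^sub>R (q - p) + t *\<^sub>R (r - p)"
      unfolding comb k by (simp add: algebra_simps)
    then show ?thesis by blast
  qed
  ultimately obtain a1 a2 b1 b2 c1 c2 d1 d2 where
    a: "a = p + a1 *\<^sub>R (q - p) + a2 *\<^sub>R (r - p)" and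
    b: "b = p + b1 *\<^sub>R (q - p) + b2 *\<^sub>R (r - p)" and
    c: "c = p + c1 *\<^sub>R (q - p) + c2 *\<^sub>R (r - p)" and
    d: "d = p + d1 *\<^sub>R (q - p) + d2 *\<^sub>R (r - p)"
    by (metis insert_subset)
  have diff: "(p + s *\<^sub>R y + t *\<^sub>R z) - (p + s' *\<^sub>R y + t' *\<^sub>R z) = (s - s') *\<^sub>R y + (t - t') *\<^sub>R z"
    for s t s' t' and y z :: "real ^ 3"
    by (simp add: algebra_simps)
  \<comment> \<open>All differences combine \<open>q - p\<close> and \<open>r - p\<close> only, so
    the cross product is a multiple of \<open>cross3 (q - p) (r - p)\<close>, which is orthogonal to
    both.\<close>
  show "(b - a) \<bullet> cross3 (c - a) (d - a) = 0"
    unfolding a b c d diff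
    by (simp add: cross_add_left cross_add_right cross_mult_left cross_mult_right
        inner_add_left inner_diff_right dot_cross_self cross_skew[of "r - p" "q - p"])
next
  assume triple: "(b - a) \<bullet> cross3 (c - a) (d - a) = 0"
  show "coplanar {a, b, c, d}"
  proof (cases "cross3 (c - a) (d - a) = 0")
    case False
    then obtain s t where "b - a = s *\<^sub>R (c - a) + t *\<^sub>R (d - a)"
      using triple_product_zero_imp_combination[OF triple] by blast
    then have "b = (1 - s - t) *\<^sub>R a + s *\<^sub>R c + t *\<^sub>R d"
      by (simp add: algebra_simps)
    moreover have "(1 - s - t) + s + t = 1"
      by simp
    ultimately have "b \<in> affine hull {a, c, d}"
      unfolding affine_hull_3 by blast
    then have "{a, b, c, d} \<subseteq> affine hull {a, c, d}"
      by (auto intro: hull_inc)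
    then show ?thesis
      unfolding coplanar_def by blast
  next
    case True
    then have "collinear {a, c, d}"
      using collinear_3[of c a d] by (simp add: cross_eq_0 insert_commute)
    show ?thesis
    \<comment> \<open>If \<open>a = c\<close>, at most three points remain. Otherwise
      \<open>a\<close> and \<open>c\<close> determine the line that contains
      \<open>d\<close>.\<close>
    proof (cases "a = c")
      case True
      then show ?thesis
        using coplanar_3[of a b d] by (simp add: insert_commute)
    next
      case False
      with \<open>collinear {a, c, d}\<close> have "d \<in> affine hull {a, c}"
        by (rule collinear_3_imp_in_affine_hull)
      also have "\<dots> \<subseteq> affine hull {a, b, c}"
        by (rule hull_mono) auto
      finally have "{a, b, c, d} \<subseteq> affine hull {a, b, c}"
        by (auto intro: hull_inc)
      then show ?thesis
        unfolding coplanar_def by blast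
    qed
  qed
qed

theorem mainTheorem1:
  fixes \<alpha> \<beta> \<gamma> \<delta> u v :: real
    and P1 P2 P3 P4 :: "real ^ 3"
  assumes "\<alpha> > 0" and "\<beta> > 0" and "\<gamma> > 0" and "\<delta> > 0"
    and "u > 0" and "v > 0"
    and "dist P1 P2 = \<alpha>" and "dist P2 P3 = \<beta>"
    and "dist P3 P4 = \<gamma>" and "dist P4 P1 = \<delta>"
    and "dist P1 P3 = u" and "dist P2 P4 = v"
  shows "let h11 = - (\<alpha>^2 + \<beta>^2 + \<gamma>^2 + \<delta>^2);
             h10 = - ((\<beta>^2 - \<gamma>^2) * (\<delta>^2 - \<alpha>^2));
             h01 = - ((\<alpha>^2 - \<beta>^2) * (\<gamma>^2 - \<delta>^2));
             h00 = (\<alpha>^2 * \<gamma>^2 - \<beta>^2 * \<delta>^2) * (\<alpha>^2 - \<beta>^2 + \<gamma>^2 - \<delta>^2)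
         in coplanar {P1, P2, P3, P4} \<longleftrightarrow>
              u^4 * v^2 + u^2 * v^4 + h11 * u^2 * v^2 + h10 * u^2 + h01 * v^2 + h00 = 0"
proof -
  define x y z where "x = P2 - P1" and "y = P3 - P1" and "z = P4 - P1"
  have \<alpha>: "\<alpha>\<^sup>2 = x \<bullet> x" and \<delta>: "\<delta>\<^sup>2 = z \<bullet> z" and u: "u\<^sup>2 = y \<bullet> y"
    unfolding x_def y_def z_def
    by (simp_all flip: assms(7) assms(10) assms(11)
        add: dist_norm norm_minus_commute power2_norm_eq_inner[symmetric])
  \<comment> \<open>Law of cosines seen from a base point \<open>a\<close>; with
    \<open>a = P1\<close> it gives the three lengths between points other than
    \<open>P1\<close>.\<close>
  have sq: "(dist p q)\<^sup>2 = (p - a) \<bullet> (p - a) + (q - a) \<bullet> (q - a) - 2 * ((p - a) \<bullet> (q - a))"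
    for p q a :: "real ^ 3"
    by (simp add: dist_norm power2_norm_eq_inner inner_diff_left inner_diff_right inner_commute)
  have \<beta>: "\<beta>\<^sup>2 = x \<bullet> x + y \<bullet> y - 2 * (x \<bullet> y)"
    and \<gamma>: "\<gamma>\<^sup>2 = y \<bullet> y + z \<bullet> z - 2 * (y \<bullet> z)"
    and v: "v\<^sup>2 = x \<bullet> x + z \<bullet> z - 2 * (x \<bullet> z)"
    unfolding x_def y_def z_def by (simp_all flip: assms(8) assms(9) assms(12) add: sq[of _ _ P1])
  \<comment> \<open>Lengths enter only through their squares, so the claim becomes a polynomial
    identity in the six inner products of \<open>x, y, z\<close>.\<close>
  have fourth: "w ^ 4 = (w\<^sup>2)\<^sup>2" for w :: real
    by simp
  have "u^4 * v^2 + u^2 * v^4 + (- (\<alpha>^2 + \<beta>^2 + \<gamma>^2 + \<delta>^2)) * u^2 * v^2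
      + (- ((\<beta>^2 - \<gamma>^2) * (\<delta>^2 - \<alpha>^2))) * u^2 + (- ((\<alpha>^2 - \<beta>^2) * (\<gamma>^2 - \<delta>^2))) * v^2
      + (\<alpha>^2 * \<gamma>^2 - \<beta>^2 * \<delta>^2) * (\<alpha>^2 - \<beta>^2 + \<gamma>^2 - \<delta>^2)
      = - 4 * (x \<bullet> cross3 y z)\<^sup>2"
    unfolding gram_det_eq_triple_product_sq fourth \<alpha> \<beta> \<gamma> \<delta> u v by algebra
  then show ?thesis
    unfolding Let_def coplanar_4_iff_triple_product_zero
      x_def[symmetric] y_def[symmetric] z_def[symmetric]
    by simp
qed

end
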